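(* $P_6\le C_5$.
   Context: All graphs are finite and simple, considered up to isomorphism. An edge-colored graph is a pair $(G,c)$ with $c\colon E(G)\to\mathbb{N}$ an arbitrary map (not necessarily proper); it is colored in $t$ or more colors if $|c(E(G))|\ge t$. A subgraph (not necessarily induced) is rainbow if its edges receive pairwise distinct colors. $(G,c)$ is rainbow $H$-free if $G$ contains no rainbow subgraph isomorphic to $H$. For graphs $H_1,H_2$, write $H_1\le H_2$ if there is a positive integer $t$ such that every rainbow $H_1$-free edge-colored complete graph colored in $t$ or more colors is rainbow $H_2$-free. $P_k$ and $C_k$ are the path and the cycle on $k$ vertices. *)

theory Defs
  imports "HOL-Library.Ramsey"
begin

text \<open>
  A graph is a pair of a vertex set and an edge set; an edge is a two-element set of vertices.
  \<open>nsets V 2\<close>, also written \<open>[V]\<^bsup>2\<^esup>\<close>, is the set of all two-element subsets of \<open>V\<close>.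
\<close>

type_synonym 'a ugraph = "'a set \<times> 'a set set"

abbreviation verts :: "'a ugraph \<Rightarrow> 'a set" where
  "verts G \<equiv> fst G"

abbreviation edges :: "'a ugraph \<Rightarrow> 'a set set" where
  "edges G \<equiv> snd G"

definition simple_graph :: "'a ugraph \<Rightarrow> bool" where
  "simple_graph G \<longleftrightarrow> finite (verts G) \<and> edges G \<subseteq> nsets (verts G) 2"

definition complete_graph :: "'a ugraph \<Rightarrow> bool" where
  "complete_graph G \<longleftrightarrow> finite (verts G) \<and> edges G = nsets (verts G) 2"

definition subgraph :: "'a ugraph \<Rightarrow> 'a ugraph \<Rightarrow> bool" where
  "subgraph S G \<longleftrightarrow> simple_graph S \<and> verts S \<subseteq> verts G \<and> edges S \<subseteq> edges G"

definition isomorphic :: "'a ugraph \<Rightarrow> 'b ugraph \<Rightarrow> bool" where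
  "isomorphic G H \<longleftrightarrow>
     (\<exists>f. bij_betw f (verts G) (verts H) \<and>
          (\<forall>u\<in>verts G. \<forall>v\<in>verts G. {u, v} \<in> edges G \<longleftrightarrow> {f u, f v} \<in> edges H))"

definition path_graph :: "nat \<Rightarrow> nat ugraph" where
  "path_graph k = ({..<k}, {{i, Suc i} | i. Suc i < k})"

text \<open>As usual, the cycle on \<open>k\<close> vertices is only meaningful for \<open>k \<ge> 3\<close>.\<close>

definition cycle_graph :: "nat \<Rightarrow> nat ugraph" where
  "cycle_graph k = ({..<k}, {{i, Suc i mod k} | i. i < k})"

text \<open>
  An edge-coloring of \<open>G\<close> is given by a total function on sets of vertices; only its values on
  \<open>edges G\<close> matter.
\<close>

definition colored_in_at_least :: "nat \<Rightarrow> 'a ugraph \<Rightarrow> ('a set \<Rightarrow> nat) \<Rightarrow> bool" where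
  "colored_in_at_least t G c \<longleftrightarrow> t \<le> card (c ` edges G)"

definition rainbow :: "('a set \<Rightarrow> nat) \<Rightarrow> 'a ugraph \<Rightarrow> bool" where
  "rainbow c S \<longleftrightarrow> inj_on c (edges S)"

definition rainbow_free :: "'b ugraph \<Rightarrow> 'a ugraph \<Rightarrow> ('a set \<Rightarrow> nat) \<Rightarrow> bool" where
  "rainbow_free H G c \<longleftrightarrow> \<not> (\<exists>S. subgraph S G \<and> rainbow c S \<and> isomorphic S H)"

text \<open>
  Finite graphs being considered up to isomorphism, it suffices to let the complete graph range
  over those whose vertices are natural numbers.
\<close>

definition rainbow_le :: "'a ugraph \<Rightarrow> 'b ugraph \<Rightarrow> bool" (infix \<open>\<preceq>\<^sub>r\<close> 50) where
  "H1 \<preceq>\<^sub>r H2 \<longleftrightarrow>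
     (\<exists>t::nat. t > 0 \<and>
        (\<forall>(G :: nat ugraph) (c :: nat set \<Rightarrow> nat).
           complete_graph G \<longrightarrow> colored_in_at_least t G c \<longrightarrow>
           rainbow_free H1 G c \<longrightarrow> rainbow_free H2 G c))"

lemma simple_graph_path_graph: "simple_graph (path_graph k)"
  by (auto simp: simple_graph_def path_graph_def nsets_def)

lemma simple_graph_cycle_graph:
  assumes "k \<ge> 3"
  shows "simple_graph (cycle_graph k)"
proof -
  have "i \<noteq> Suc i mod k" if "i < k" for i
    using that assms by (cases "Suc i = k") auto
  then show ?thesis
    using assms by (auto simp: simple_graph_def cycle_graph_def nsets_def)
qed

end

theory Submission
  imports Defs
begin

text \<open>
  Let \<open>v\<^sub>0, \<dots>, v\<^sub>4\<close> be a rainbow pentagon whose edge \<open>v\<^sub>i v\<^sub>i\<^sub>+\<^sub>1\<close> has color \<open>i\<close> (indices mod 5) and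
  suppose that there is no rainbow \<open>P\<^sub>6\<close>. For a vertex \<open>u\<close> off the pentagon, the two paths that start
  with \<open>u v\<^sub>i\<close> and run around the pentagon show that \<open>u v\<^sub>i\<close> has one of the colors
  \<open>i + 1, i + 2, i + 3\<close>. If an edge \<open>u w\<close> off the pentagon had none of the colors \<open>0, \<dots>, 4\<close>, then the
  paths starting with \<open>w u v\<^sub>i\<close> would force \<open>u v\<^sub>i\<close>, and by symmetry \<open>w v\<^sub>i\<close>, to have color \<open>i + 2\<close>;
  but then \<open>v\<^sub>4 v\<^sub>0 u w v\<^sub>1 v\<^sub>2\<close> is rainbow. So every color occurs on one of the 10 edges spanned by
  the pentagon.
\<close>

section \<open>Rainbow copies as injective vertex maps\<close>

text \<open>In a complete graph every injective placement of the vertices of \<open>H\<close>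
  carries all edges along, so only the placement and its colors matter. From a copy
  \<open>S\<close>, the placement is the inverse of the isomorphism.\<close>

lemma rainbow_free_iff:
  assumes H: "simple_graph H" and G: "complete_graph G"
  shows "rainbow_free H G c \<longleftrightarrow>
    \<not> (\<exists>p. inj_on p (verts H) \<and> p ` verts H \<subseteq> verts G \<and> inj_on (\<lambda>e. c (p ` e)) (edges H))"
proof -
  have "(\<exists>S. subgraph S G \<and> rainbow c S \<and> isomorphic S H) \<longleftrightarrow>
    (\<exists>p. inj_on p (verts H) \<and> p ` verts H \<subseteq> verts G \<and> inj_on (\<lambda>e. c (p ` e)) (edges H))"
  proof
    assume "\<exists>S. subgraph S G \<and> rainbow c S \<and> isomorphic S H"
    then obtain S f where S: "subgraph S G" "rainbow c S" and f: "bij_betw f (verts S) (verts H)"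
      and iso: "\<And>u v. u \<in> verts S \<Longrightarrow> v \<in> verts S \<Longrightarrow> {u, v} \<in> edges S \<longleftrightarrow> {f u, f v} \<in> edges H"
      unfolding isomorphic_def by blast
    define p where "p = inv_into (verts S) f"
    have p: "bij_betw p (verts H) (verts S)"
      unfolding p_def by (rule bij_betw_inv_into[OF f])
    have fp: "f (p i) = i" and pS: "p i \<in> verts S" if "i \<in> verts H" for i
      using f p that unfolding p_def by (auto simp: bij_betw_inv_into_right bij_betwE)
    have sub: "e \<subseteq> verts H" if "e \<in> edges H" for e
      using H that unfolding simple_graph_def nsets_def by blast
    have edge: "p ` e \<in> edges S" if e: "e \<in> edges H" for e
    proof -
      have "card e = 2"
        using H e unfolding simple_graph_def nsets_def by blast
      then obtain i j where ij: "e = {i, j}"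
        by (auto simp: card_2_iff)
      then have "i \<in> verts H" "j \<in> verts H"
        using sub[OF e] by auto
      then show ?thesis
        using iso[of "p i" "p j"] e ij by (simp add: fp pS)
    qed
    have "inj_on (\<lambda>e. p ` e) (edges H)"
      using bij_betw_imp_inj_on[OF p] sub by (meson inj_on_image_eq_iff inj_onI)
    moreover have "inj_on c ((\<lambda>e. p ` e) ` edges H)"
      using S(2) edge unfolding rainbow_def by (auto intro: inj_on_subset)
    ultimately have "inj_on (\<lambda>e. c (p ` e)) (edges H)"
      using comp_inj_on unfolding comp_def by blast
    then show "\<exists>p. inj_on p (verts H) \<and> p ` verts H \<subseteq> verts G \<and> inj_on (\<lambda>e. c (p ` e)) (edges H)"
      using p S(1) unfolding bij_betw_def subgraph_def by blast
  next
    assume "\<exists>p. inj_on p (verts H) \<and> p ` verts H \<subseteq> verts G \<and> inj_on (\<lambda>e. c (p ` e)) (edges H)"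
    then obtain p where p: "inj_on p (verts H)" "p ` verts H \<subseteq> verts G"
      and rb: "inj_on (\<lambda>e. c (p ` e)) (edges H)" by blast
    define S where "S = (p ` verts H, (\<lambda>e. p ` e) ` edges H)"
    have sub: "e \<subseteq> verts H" "finite e" "card e = 2" if "e \<in> edges H" for e
      using H that unfolding simple_graph_def nsets_def by auto
    have SV: "edges S \<subseteq> nsets (verts S) 2"
      using sub p(1) by (auto simp: S_def nsets_def card_image inj_on_subset)
    then have "subgraph S G"
      using p(2) G H nsets_mono[of "verts S" "verts G" 2]
      by (auto simp: subgraph_def simple_graph_def complete_graph_def S_def)
    moreover have "rainbow c S"
      using rb by (auto simp: rainbow_def S_def inj_on_def)
    moreover have "isomorphic S H"
    proof -
      have "{p i, p j} \<in> edges S \<longleftrightarrow> {i, j} \<in> edges H" if "i \<in> verts H" "j \<in> verts H" for i j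
      proof -
        \<comment> \<open>An isomorphism must also reflect edges: injectivity of \<open>p\<close>
          keeps a non-edge of \<open>H\<close> from landing on the image of an edge.\<close>
        have "p ` {i, j} = p ` e \<longleftrightarrow> {i, j} = e" if "e \<in> edges H" for e
          using inj_on_image_eq_iff[OF p(1), of "{i, j}" e] sub(1)[OF that] \<open>i \<in> verts H\<close> \<open>j \<in> verts H\<close>
          by auto
        then show ?thesis
          by (auto simp: S_def image_iff)
      qed
      then have "\<forall>u\<in>verts S. \<forall>v\<in>verts S. {u, v} \<in> edges S \<longleftrightarrow>
          {inv_into (verts H) p u, inv_into (verts H) p v} \<in> edges H"
        using p(1) by (auto simp: S_def)
      moreover have "bij_betw (inv_into (verts H) p) (verts S) (verts H)"
        using p(1) by (simp add: S_def bij_betw_inv_into inj_on_imp_bij_betw)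
      ultimately show ?thesis
        unfolding isomorphic_def by blast
    qed
    ultimately show "\<exists>S. subgraph S G \<and> rainbow c S \<and> isomorphic S H"
      by blast
  qed
  then show ?thesis
    by (simp add: rainbow_free_def)
qed

section \<open>Six-vertex paths and pentagons given by their vertices\<close>

lemma edges_path_graph_6: "edges (path_graph 6) = {{0,1},{1,2},{2,3},{3,4},{4,5}}"
proof -
  have "{i. Suc i < 6} = {0,1,2,3,4}" by auto
  moreover have "edges (path_graph 6) = (\<lambda>i. {i, Suc i}) ` {i. Suc i < 6}"
    by (auto simp: path_graph_def)
  ultimately show ?thesis
    by (simp add: eval_nat_numeral)
qed

lemma edges_cycle_graph_5: "edges (cycle_graph 5) = {{0,1},{1,2},{2,3},{3,4},{4,0}}"
proof -
  have "{..<5::nat} = {0,1,2,3,4}" by auto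
  moreover have "edges (cycle_graph 5) = (\<lambda>i. {i, Suc i mod 5}) ` {..<5}"
    by (auto simp: cycle_graph_def)
  ultimately show ?thesis
    by simp (simp add: numeral_2_eq_2)
qed

text \<open>Naming the six vertices turns each use into a finite case distinction on which two of
  five colors agree.\<close>

definition no_rainbow_P6 :: "'a set \<Rightarrow> ('a set \<Rightarrow> 'c) \<Rightarrow> bool" where
  "no_rainbow_P6 V c \<longleftrightarrow> (\<forall>x0\<in>V. \<forall>x1\<in>V. \<forall>x2\<in>V. \<forall>x3\<in>V. \<forall>x4\<in>V. \<forall>x5\<in>V.
     distinct [x0,x1,x2,x3,x4,x5] \<longrightarrow>
     \<not> distinct [c {x0,x1}, c {x1,x2}, c {x2,x3}, c {x3,x4}, c {x4,x5}])"

definition rainbow_pentagon :: "'a set \<Rightarrow> ('a set \<Rightarrow> 'c) \<Rightarrow> 'a \<Rightarrow> 'a \<Rightarrow> 'a \<Rightarrow> 'a \<Rightarrow> 'a \<Rightarrow> bool" where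
  "rainbow_pentagon V c v0 v1 v2 v3 v4 \<longleftrightarrow>
     {v0,v1,v2,v3,v4} \<subseteq> V \<and> distinct [v0,v1,v2,v3,v4] \<and>
     distinct [c {v0,v1}, c {v1,v2}, c {v2,v3}, c {v3,v4}, c {v4,v0}]"

lemma no_rainbow_P6D:
  assumes "no_rainbow_P6 V c" "{x0,x1,x2,x3,x4,x5} \<subseteq> V" "distinct [x0,x1,x2,x3,x4,x5]"
  shows "\<not> distinct [c {x0,x1}, c {x1,x2}, c {x2,x3}, c {x3,x4}, c {x4,x5}]"
  using assms(2,3) by (intro assms(1)[unfolded no_rainbow_P6_def, rule_format]) simp_all

lemma no_rainbow_P6I:
  assumes G: "complete_graph G" and free: "rainbow_free (path_graph 6) G c"
  shows "no_rainbow_P6 (verts G) c"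
  unfolding no_rainbow_P6_def
proof (intro ballI impI notI)
  fix x0 x1 x2 x3 x4 x5
  assume V: "x0 \<in> verts G" "x1 \<in> verts G" "x2 \<in> verts G" "x3 \<in> verts G" "x4 \<in> verts G" "x5 \<in> verts G"
    and dist: "distinct [x0,x1,x2,x3,x4,x5]"
    and col: "distinct [c {x0,x1}, c {x1,x2}, c {x2,x3}, c {x3,x4}, c {x4,x5}]"
  define p where "p = nth [x0,x1,x2,x3,x4,x5]"
  have verts: "verts (path_graph 6) = {..<6}"
    by (simp add: path_graph_def)
  have "inj_on p {..<6}"
    unfolding p_def using dist by (intro inj_on_nth) auto
  moreover have "p ` {..<6} = {x0,x1,x2,x3,x4,x5}"
    using nth_image[of 6 "[x0,x1,x2,x3,x4,x5]"] by (simp add: p_def lessThan_atLeast0)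
  then have "p ` {..<6} \<subseteq> verts G"
    using V by simp
  moreover have "inj_on (\<lambda>e. c (p ` e)) (edges (path_graph 6))"
    unfolding edges_path_graph_6 using col by (auto simp: p_def)
  ultimately show False
    using free unfolding rainbow_free_iff[OF simple_graph_path_graph G] verts by blast
qed

lemma rainbow_pentagonE:
  assumes G: "complete_graph G" and nfree: "\<not> rainbow_free (cycle_graph 5) G c"
  obtains v0 v1 v2 v3 v4 where "rainbow_pentagon (verts G) c v0 v1 v2 v3 v4"
proof -
  have verts: "verts (cycle_graph 5) = {..<5}"
    by (simp add: cycle_graph_def)
  have "simple_graph (cycle_graph 5)"
    by (simp add: simple_graph_cycle_graph)
  then obtain p where p: "inj_on p {..<5}" "p ` {..<5} \<subseteq> verts G"
    and rb: "inj_on (\<lambda>e. c (p ` e)) (edges (cycle_graph 5))"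
    using nfree G by (auto simp: rainbow_free_iff verts)
  have "rainbow_pentagon (verts G) c (p 0) (p 1) (p 2) (p 3) (p 4)"
    unfolding rainbow_pentagon_def
  proof (intro conjI)
    show "{p 0, p 1, p 2, p 3, p 4} \<subseteq> verts G"
      using p(2) by auto
    show "distinct [p 0, p 1, p 2, p 3, p 4]"
      using p(1) by (auto simp: inj_on_eq_iff)
    show "distinct [c {p 0, p 1}, c {p 1, p 2}, c {p 2, p 3}, c {p 3, p 4}, c {p 4, p 0}]"
      using rb unfolding edges_cycle_graph_5 by (auto simp: doubleton_eq_iff)
  qed
  then show ?thesis
    by (rule that)
qed

section \<open>Colors forced by a rainbow pentagon\<close>

text \<open>Carries facts proved only at the first vertex \<open>v0\<close> over to the other
  four.\<close>

lemma rainbow_pentagon_rotate: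
  "rainbow_pentagon V c v0 v1 v2 v3 v4 \<Longrightarrow> rainbow_pentagon V c v1 v2 v3 v4 v0"
  unfolding rainbow_pentagon_def by auto

text \<open>One direction around omits the edge \<open>v4 v0\<close>, the other omits
  \<open>v0 v1\<close>; the color of \<open>u v0\<close> must repeat on both paths, which leaves the
  three edges away from \<open>v0\<close>.\<close>

lemma pentagon_to_outside:
  assumes path: "no_rainbow_P6 V c" and pent: "rainbow_pentagon V c v0 v1 v2 v3 v4"
    and u: "u \<in> V - {v0,v1,v2,v3,v4}"
  shows "c {u,v0} \<in> {c {v1,v2}, c {v2,v3}, c {v3,v4}}"
proof -
  have "\<not> distinct [c {u,v0}, c {v0,v1}, c {v1,v2}, c {v2,v3}, c {v3,v4}]"
    using pent u unfolding rainbow_pentagon_def by (intro no_rainbow_P6D[OF path]) auto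
  moreover have "\<not> distinct [c {u,v0}, c {v0,v4}, c {v4,v3}, c {v3,v2}, c {v2,v1}]"
    using pent u unfolding rainbow_pentagon_def by (intro no_rainbow_P6D[OF path]) auto
  \<comment> \<open>Only the orientation of edges changes; \<open>insert_commute\<close> acts as an
    ordered rewrite that gives each edge a single form.\<close>
  then have "\<not> distinct [c {u,v0}, c {v4,v0}, c {v3,v4}, c {v2,v3}, c {v1,v2}]"
    by (simp only: insert_commute not_False_eq_True)
  ultimately show ?thesis
    using pent unfolding rainbow_pentagon_def by auto
qed

lemma pentagon_to_new_edge:
  assumes path: "no_rainbow_P6 V c" and pent: "rainbow_pentagon V c v0 v1 v2 v3 v4"
    and u: "u \<in> V - {v0,v1,v2,v3,v4}" and w: "w \<in> V - {v0,v1,v2,v3,v4}" and "u \<noteq> w"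
    and new: "c {u,w} \<notin> {c {v0,v1}, c {v1,v2}, c {v2,v3}, c {v3,v4}, c {v4,v0}}"
  shows "c {u,v0} = c {v2,v3}"
proof -
  have "\<not> distinct [c {w,u}, c {u,v0}, c {v0,v1}, c {v1,v2}, c {v2,v3}]"
    using pent u w \<open>u \<noteq> w\<close> unfolding rainbow_pentagon_def
    by (intro no_rainbow_P6D[OF path]) auto
  then have "\<not> distinct [c {u,w}, c {u,v0}, c {v0,v1}, c {v1,v2}, c {v2,v3}]"
    by (simp only: insert_commute not_False_eq_True)
  moreover have "\<not> distinct [c {w,u}, c {u,v0}, c {v0,v4}, c {v4,v3}, c {v3,v2}]"
    using pent u w \<open>u \<noteq> w\<close> unfolding rainbow_pentagon_def
    by (intro no_rainbow_P6D[OF path]) auto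
  then have "\<not> distinct [c {u,w}, c {u,v0}, c {v4,v0}, c {v3,v4}, c {v2,v3}]"
    by (simp only: insert_commute not_False_eq_True)
  \<comment> \<open>\<open>pentagon_to_outside\<close> excludes that \<open>u v0\<close> itself has
    the new color. So its color repeats on both three-edge arcs from \<open>v0\<close>, whose only
    common edge is \<open>v2 v3\<close>.\<close>
  ultimately show ?thesis
    using pentagon_to_outside[OF path pent u] pent new
    unfolding rainbow_pentagon_def by auto
qed

lemma outside_edge_color:
  assumes path: "no_rainbow_P6 V c" and pent: "rainbow_pentagon V c v0 v1 v2 v3 v4"
    and u: "u \<in> V - {v0,v1,v2,v3,v4}" and w: "w \<in> V - {v0,v1,v2,v3,v4}" and "u \<noteq> w"
  shows "c {u,w} \<in> {c {v0,v1}, c {v1,v2}, c {v2,v3}, c {v3,v4}, c {v4,v0}}"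
proof (rule ccontr)
  assume new: "\<not> ?thesis"
  have "c {u,v0} = c {v2,v3}"
    using pentagon_to_new_edge[OF path pent u w \<open>u \<noteq> w\<close>] new by blast
  \<comment> \<open>The roles of \<open>u\<close> and \<open>w\<close> are exchanged and the
    pentagon is rotated by one; the edge opposite to \<open>v1\<close> is
    \<open>v3 v4\<close>.\<close>
  moreover have "c {w,v1} = c {v3,v4}"
    using pentagon_to_new_edge[OF path rainbow_pentagon_rotate[OF pent], of w u] u w \<open>u \<noteq> w\<close> new
    by (simp add: insert_commute)
  \<comment> \<open>In the numbering of colors by pentagon edges, this path has colors 4, 2, new, 3,
    1.\<close>
  moreover have "\<not> distinct [c {v4,v0}, c {v0,u}, c {u,w}, c {w,v1}, c {v1,v2}]"
    using pent u w \<open>u \<noteq> w\<close> unfolding rainbow_pentagon_def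
    by (intro no_rainbow_P6D[OF path]) auto
  then have "\<not> distinct [c {v4,v0}, c {u,v0}, c {u,w}, c {w,v1}, c {v1,v2}]"
    by (simp only: insert_commute not_False_eq_True)
  ultimately show False
    using pent new unfolding rainbow_pentagon_def by auto
qed

text \<open>Edges leaving or avoiding the pentagon repeat colors of its five sides; its diagonals
  are unrestricted, so the bound is by all edges spanned by the five vertices.\<close>

lemma colors_on_pentagon:
  assumes path: "no_rainbow_P6 V c" and pent: "rainbow_pentagon V c v0 v1 v2 v3 v4"
  shows "c ` nsets V 2 \<subseteq> c ` nsets {v0,v1,v2,v3,v4} 2"
proof -
  let ?C = "{v0,v1,v2,v3,v4}"
  let ?K = "{c {v0,v1}, c {v1,v2}, c {v2,v3}, c {v3,v4}, c {v4,v0}}"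
  have K: "?K \<subseteq> c ` nsets ?C 2"
    using pent unfolding rainbow_pentagon_def by (auto simp: nsets_def)
  note r1 = rainbow_pentagon_rotate[OF pent]
  note r2 = rainbow_pentagon_rotate[OF r1]
  note r3 = rainbow_pentagon_rotate[OF r2]
  note r4 = rainbow_pentagon_rotate[OF r3]
  \<comment> \<open>One rotation for each possible end \<open>v\<close> on the pentagon.\<close>
  have half: "c {u,v} \<in> ?K" if "u \<in> V - ?C" "v \<in> ?C" for u v
    using that pentagon_to_outside[OF path pent, of u] pentagon_to_outside[OF path r1, of u]
      pentagon_to_outside[OF path r2, of u] pentagon_to_outside[OF path r3, of u]
      pentagon_to_outside[OF path r4, of u]
    by auto
  show ?thesis
  proof (rule image_subsetI)
    fix e assume "e \<in> nsets V 2"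
    then obtain u w where e: "e = {u,w}" "u \<noteq> w" "u \<in> V" "w \<in> V"
      by (auto simp: nsets_def card_2_iff)
    show "c e \<in> c ` nsets ?C 2"
    proof (cases "u \<in> ?C \<and> w \<in> ?C")
      case True
      then show ?thesis
        using e by (intro imageI) (auto simp: nsets_def)
    next
      case False
      then have "c {u,w} \<in> ?K"
        using half[of u w] half[of w u] outside_edge_color[OF path pent, of u w] e
        by (metis DiffI insert_commute)
      then show ?thesis
        using K e(1) by blast
    qed
  qed
qed

theorem theorem10:
  shows "path_graph 6 \<preceq>\<^sub>r cycle_graph 5"
  unfolding rainbow_le_def
\<comment> \<open>Five vertices span 10 edges, hence at most 10 colors occur next to a rainbow
  pentagon, and 11 is one more.\<close>
proof (intro exI[of _ 11] conjI allI impI)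
  fix G :: "nat ugraph" and c :: "nat set \<Rightarrow> nat"
  assume G: "complete_graph G" and many: "colored_in_at_least 11 G c"
    and free: "rainbow_free (path_graph 6) G c"
  show "rainbow_free (cycle_graph 5) G c"
  proof (rule ccontr)
    assume "\<not> ?thesis"
    then obtain v0 v1 v2 v3 v4 where pent: "rainbow_pentagon (verts G) c v0 v1 v2 v3 v4"
      using rainbow_pentagonE[OF G] by blast
    let ?C = "{v0,v1,v2,v3,v4}"
    have "card ?C = 5"
      using pent unfolding rainbow_pentagon_def by simp
    then have "card (nsets ?C 2) = 10"
      by (simp add: card_nsets choose_two)
    moreover have "finite (nsets ?C 2)"
      by (simp add: finite_imp_finite_nsets)
    ultimately have "card (c ` nsets (verts G) 2) \<le> 10"
      using colors_on_pentagon[OF no_rainbow_P6I[OF G free] pent]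
      by (metis card_image_le card_mono finite_imageI order_trans)
    then show False
      using many G by (simp add: colored_in_at_least_def complete_graph_def)
  qed
qed simp

end
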